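(* Let $P$ be a tropical polytope in $\mathbb{T}^d$ and $Q$ a tropical polytope in $\mathbb{T}^e$. Then $P\times Q$ is a tropical polytope in $\mathbb{T}^{d+e}$ and $$\mathrm{tbvol}(P\times Q)=\mathrm{tbvol}(P)\odot\mathrm{tbvol}(Q).$$
   Context: $\mathbb{T}=\mathbb{R}\cup\{-\infty\}$ with $x\oplus y=\max(x,y)$, $x\odot y=x+y$. For $V\subseteq\mathbb{T}^d$, $\mathrm{tconv}(V)=\{\bigoplus_{j=1}^n\lambda_j\odot v_j:\lambda_j\in\mathbb{T},\ \bigoplus_j\lambda_j=0,\ v_j\in V\}$. A tropical polytope is $\mathrm{tconv}(V)$ for a finite set $V$; its vertices are the elements of its unique minimal generating set. Covector decomposition of a tropical polytope $P\subseteq\mathbb{T}^d$: let $v_1,\dots,v_n$ be the vertices of $P$, $v_j=(v_{1j},\dots,v_{dj})$, and put $v_{0j}=0$, $x_0=0$. For $G\subseteq\{0,\dots,d\}\times[n]$ let $C_G=\{x\in\mathbb{T}^d: v_{kj}+x_i\le v_{ij}+x_k\text{ for all }(i,j)\in G,\ k\in\{0,\dots,d\}\}$. The closed cells of the covector decomposition of $P$ are the nonempty $C_G$ for which every $i\in\{0,\dots,d\}$ occurs in some $(i,j)\in G$ and every $j\in[n]$ occurs in some $(i,j)\in G$ with $v_{ij}\ne-\infty$. Their union is $P$, and their images under $x\mapsto(b^{x_1},\dots,b^{x_d})$ ($b>1$, $b^{-\infty}=0$) are convex polytopes forming a polyhedral complex; the dimension of a cell is the dimension of its image. The $d$-trunk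 $\mathrm{Tr}_d(P)$ is the union of all closed cells of dimension $d$. Tropical barycentric volume of a tropical polytope $P\subseteq\mathbb{T}^d$: $\mathrm{tbvol}(P)=\max_{x\in\mathrm{Tr}_d(P)}(x_1+\dots+x_d)$, with $\max\emptyset=-\infty$. *)

theory Defs
  imports "HOL-Analysis.Analysis"
begin

text \<open>
  The tropical semiring is the set of extended reals different from \<open>\<infinity>\<close>, with maximum as
  tropical addition and \<open>+\<close> as tropical multiplication. A point of tropical \<open>d\<close>-space is a
  vector \<open>x :: ereal^'d\<close> with \<open>CARD('d) = d\<close> and no coordinate equal to \<open>\<infinity>\<close>.
\<close>

definition trop :: "ereal set" where
  "trop = {a. a \<noteq> \<infinity>}"

definition tspace :: "(ereal^'d) set" where
  "tspace = {x. \<forall>i. x $ i \<in> trop}"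

text \<open>
  A finite tropical sum is a supremum in the complete lattice \<open>ereal\<close>; the supremum of
  the empty family is \<open>-\<infinity>\<close>, so \<open>n = 0\<close> is ruled out by the normalisation of \<open>l\<close>.
\<close>

definition tconv :: "(ereal^'d) set \<Rightarrow> (ereal^'d) set" where
  "tconv V = {x. \<exists>(n::nat) l v.
      (\<forall>j\<in>{1..n}. l j \<in> trop \<and> v j \<in> V) \<and>
      (SUP j\<in>{1..n}. l j) = 0 \<and>
      x = (\<chi> i. SUP j\<in>{1..n}. l j + v j $ i)}"

definition tropical_polytope :: "(ereal^'d) set \<Rightarrow> bool" where
  "tropical_polytope P \<longleftrightarrow> (\<exists>V. finite V \<and> V \<subseteq> tspace \<and> P = tconv V)"

definition minimal_generating_set :: "(ereal^'d) set \<Rightarrow> (ereal^'d) set \<Rightarrow> bool" where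
  "minimal_generating_set P V \<longleftrightarrow>
     V \<subseteq> tspace \<and> tconv V = P \<and> (\<forall>W. W \<subset> V \<longrightarrow> tconv W \<noteq> P)"

definition vertices :: "(ereal^'d) set \<Rightarrow> (ereal^'d) set" where
  "vertices P = (THE V. minimal_generating_set P V)"

text \<open>
  The index set \<open>{0,\<dots>,d}\<close> is \<open>'d option\<close>, with \<open>None\<close> as the additional
  index \<open>0\<close>, at which every point has coordinate \<open>0\<close>.
\<close>

definition hcoord :: "ereal^'d \<Rightarrow> 'd option \<Rightarrow> ereal" where
  "hcoord x i = (case i of None \<Rightarrow> 0 | Some m \<Rightarrow> x $ m)"

text \<open>
  In a pair \<open>(i, v)\<close> of \<open>G\<close>, the vertex \<open>v\<close> itself plays the role of its index \<open>j\<close>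
  in an enumeration of the vertices.
\<close>

definition covector_cell :: "('d option \<times> (ereal^'d)) set \<Rightarrow> (ereal^'d) set" where
  "covector_cell G = {x \<in> tspace. \<forall>(i, v)\<in>G. \<forall>k.
      hcoord v k + hcoord x i \<le> hcoord v i + hcoord x k}"

definition closed_cells :: "(ereal^'d) set \<Rightarrow> (ereal^'d) set set" where
  "closed_cells P = {covector_cell G | G.
      G \<subseteq> UNIV \<times> vertices P \<and>
      covector_cell G \<noteq> {} \<and>
      (\<forall>i. \<exists>v. (i, v) \<in> G) \<and>
      (\<forall>v\<in>vertices P. \<exists>i. (i, v) \<in> G \<and> hcoord v i \<noteq> -\<infinity>)}"

text \<open>
  The case distinction is needed because \<open>real_of_ereal (-\<infinity>) = 0\<close>.
\<close>

definition texp :: "real \<Rightarrow> ereal^'d \<Rightarrow> real^'d" where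
  "texp b x = (\<chi> i. if x $ i = -\<infinity> then 0 else b powr real_of_ereal (x $ i))"

definition cell_dim :: "real \<Rightarrow> (ereal^'d) set \<Rightarrow> int" where
  "cell_dim b C = aff_dim (texp b ` C)"

definition trunk :: "real \<Rightarrow> (ereal^'d) set \<Rightarrow> (ereal^'d) set" where
  "trunk b P = \<Union>{C \<in> closed_cells P. cell_dim b C = int CARD('d)}"

text \<open>
  The base \<open>b\<close> is an arbitrary real number greater than \<open>1\<close>; it enters only through the
  dimension of the cells.
\<close>

definition tbvol :: "real \<Rightarrow> (ereal^'d) set \<Rightarrow> ereal" where
  "tbvol b P =
     (if trunk b P = {} then -\<infinity>
      else (GREATEST s. s \<in> (\<lambda>x. \<Sum>i\<in>UNIV. x $ i) ` trunk b P))"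

text \<open>
  The Cartesian product as a subset of tropical \<open>(d+e)\<close>-space, the coordinates of which are
  indexed by the disjoint sum \<open>'d + 'e\<close>.
\<close>

definition tprod :: "(ereal^'d) set \<Rightarrow> (ereal^'e) set \<Rightarrow> (ereal^('d + 'e)) set" where
  "tprod P Q = {x. (\<chi> i. x $ Inl i) \<in> P \<and> (\<chi> j. x $ Inr j) \<in> Q}"

end

theory Submission imports Defs begin

text \<open>
  In the coordinates \<open>y = b\<^sup>x\<close> a polytope is the finite union of its closed cells, which are
  closed and convex. A closed convex set of dimension \<open>d\<close> is the closure of its interior, while
  finitely many closed convex sets of smaller dimension have no interior. So the trunk is the
  closure of the interior of the polytope, a description which does not mention the vertices and
  is compatible with products: the trunk of \<open>P \<times> Q\<close> is the product of the trunks, although the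
  covector decomposition of \<open>P \<times> Q\<close> is not the product of the decompositions. The
  maximum of a sum of functions of separate variables over a product is the sum of the maxima.
\<close>

section \<open>Sectors and tropical convex hulls\<close>

text \<open>Membership says that the index \<open>i\<close> minimises the differences of the
  coordinates of \<open>x\<close> and \<open>v\<close>. The additive form avoids subtracting
  infinite values, and every covector cell is an intersection of sectors within
  \<open>tspace\<close>.\<close>

definition sector :: "'d option \<Rightarrow> ereal^'d \<Rightarrow> (ereal^'d) set" where
  "sector i v = {x. \<forall>k. hcoord v k + hcoord x i \<le> hcoord v i + hcoord x k}"

lemma hcoord_None [simp]: "hcoord x None = 0"
  and hcoord_Some [simp]: "hcoord x (Some m) = x $ m"
  by (simp_all add: hcoord_def)

lemma hcoord_tspace: "x \<in> tspace \<Longrightarrow> hcoord x i \<noteq> \<infinity>"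
  by (cases i) (auto simp: tspace_def trop_def)

lemma hcoord_eqI: "(\<And>k. hcoord x k = hcoord y k) \<Longrightarrow> x = y"
  by (metis hcoord_Some vec_eq_iff)

lemma sector_minus_infinity:
  "hcoord x i = -\<infinity> \<Longrightarrow> v \<in> tspace \<Longrightarrow> x \<in> sector i v"
proof -
  assume *: "hcoord x i = -\<infinity>" "v \<in> tspace"
  have "hcoord v k + hcoord x i = -\<infinity>" for k
    unfolding ereal_plus_eq_MInfty using * hcoord_tspace[of v k] by simp
  then show "x \<in> sector i v"
    unfolding sector_def by (intro CollectI allI) (simp only: ereal_less_eq)
qed

text \<open>The instance \<open>k = None\<close>, where both points have coordinate
  \<open>0\<close>.\<close>

lemma sector_le: "x \<in> sector i v \<Longrightarrow> hcoord x i \<le> hcoord v i"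
  unfolding sector_def by (auto dest: spec[of _ None])

text \<open>The two inequalities add up and \<open>hcoord u i\<close> cancels. By
  \<open>sector_le\<close> the coordinates at \<open>i\<close> are all real as soon as
  \<open>hcoord x i\<close> is not \<open>-\<infinity>\<close>, and otherwise
  \<open>sector_minus_infinity\<close> applies.\<close>

lemma sector_trans:
  assumes "x \<in> sector i u" "u \<in> sector i v"
    and ts: "x \<in> tspace" "u \<in> tspace" "v \<in> tspace"
  shows "x \<in> sector i v"
proof (cases "hcoord x i = -\<infinity>")
  case True
  then show ?thesis using ts(3) by (rule sector_minus_infinity)
next
  case False
  have "hcoord x i \<le> hcoord u i" "hcoord u i \<le> hcoord v i"
    using assms by (auto intro: sector_le)
  with False hcoord_tspace[OF ts(1), of i] hcoord_tspace[OF ts(2), of i] hcoord_tspace[OF ts(3), of i]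
  obtain p q r where pqr: "hcoord x i = ereal p" "hcoord u i = ereal q" "hcoord v i = ereal r"
    by (cases "hcoord x i"; cases "hcoord u i"; cases "hcoord v i") auto
  have "hcoord v k + hcoord x i \<le> hcoord v i + hcoord x k" for k
  proof -
    have "hcoord u k + hcoord x i \<le> hcoord u i + hcoord x k"
      "hcoord v k + hcoord u i \<le> hcoord v i + hcoord u k"
      using assms by (auto simp: sector_def)
    then show ?thesis
      unfolding pqr
      using hcoord_tspace[OF ts(1), of k] hcoord_tspace[OF ts(2), of k] hcoord_tspace[OF ts(3), of k]
      by (cases "hcoord x k"; cases "hcoord u k"; cases "hcoord v k") auto
  qed
  then show ?thesis by (simp add: sector_def)
qed

lemma finite_SUP_attained:
  fixes f :: "'a \<Rightarrow> ereal"
  assumes "finite A" "A \<noteq> {}"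
  shows "\<exists>a\<in>A. (SUP a\<in>A. f a) = f a"
proof -
  have "Sup (f ` A) = Max (f ` A)" using assms by (simp add: Max_Sup)
  moreover have "Max (f ` A) \<in> f ` A" using assms by simp
  ultimately show ?thesis by auto
qed

text \<open>The largest multiple of \<open>v\<close> below \<open>x\<close> has as scalar the
  minimum of the differences of coordinates, and it touches \<open>x\<close> at \<open>i\<close>
  exactly if that minimum is attained at \<open>i\<close>, for finite coordinates. Hence one
  generator per index suffices, and scalars disappear from the description.\<close>

lemma tconv_iff:
  fixes V :: "(ereal^'d) set"
  assumes V: "V \<subseteq> tspace"
  shows "x \<in> tconv V \<longleftrightarrow> x \<in> tspace \<and> (\<forall>i. \<exists>v\<in>V. x \<in> sector i v)"
proof
  assume "x \<in> tconv V"
  then obtain n :: nat and l v where lv: "\<And>j. j \<in> {1..n} \<Longrightarrow> l j \<in> trop \<and> v j \<in> V"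
    and s: "(SUP j\<in>{1..n}. l j) = 0" and x: "x = (\<chi> i. SUP j\<in>{1..n}. l j + v j $ i)"
    unfolding tconv_def by blast
  have ne: "{1..n} \<noteq> {}" 
  proof
    assume "{1..n} = {}"
    then have "(SUP j\<in>{1..n}. l j) = -\<infinity>" by (simp only: image_empty Sup_empty bot_ereal_def)
    with s show False by simp
  qed
  \<comment> \<open>At \<open>None\<close> this is the normalisation of the scalars, so index
    \<open>0\<close> needs no separate treatment.\<close>
  have hx: "hcoord x i = (SUP j\<in>{1..n}. l j + hcoord (v j) i)" for i
    using s by (cases i) (auto simp: x)
  have att: "\<exists>j\<in>{1..n}. hcoord x i = l j + hcoord (v j) i" for i
    unfolding hx by (intro finite_SUP_attained ne) simp
  have "x \<in> tspace"
    unfolding tspace_def trop_def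
  proof safe
    fix i assume "x $ i = \<infinity>"
    with att[of "Some i"] obtain j where "j \<in> {1..n}" "l j + v j $ i = \<infinity>" by auto
    with lv[of j] V show False by (auto simp: trop_def tspace_def)
  qed
  moreover have "\<exists>v\<in>V. x \<in> sector i v" for i
  proof -
    obtain j where j: "j \<in> {1..n}" "hcoord x i = l j + hcoord (v j) i" using att by blast
    have "hcoord (v j) k + hcoord x i \<le> hcoord (v j) i + hcoord x k" for k
    proof -
      have "l j + hcoord (v j) k \<le> hcoord x k" unfolding hx by (rule SUP_upper[OF j(1)])
      then have "hcoord (v j) i + (l j + hcoord (v j) k) \<le> hcoord (v j) i + hcoord x k"
        by (rule add_left_mono)
      then show ?thesis by (simp add: j(2) ac_simps)
    qed
    with lv[OF j(1)] show ?thesis by (auto simp: sector_def)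
  qed
  ultimately show "x \<in> tspace \<and> (\<forall>i. \<exists>v\<in>V. x \<in> sector i v)" by blast
next
  assume "x \<in> tspace \<and> (\<forall>i. \<exists>v\<in>V. x \<in> sector i v)"
  then obtain v where xt: "x \<in> tspace" and v: "\<And>i. v i \<in> V" "\<And>i. x \<in> sector i (v i)" by metis
  \<comment> \<open>The case distinction is needed because \<open>-\<infinity> - (-\<infinity>) = \<infinity>\<close> in \<open>ereal\<close>.\<close>
  define l where "l i = (if hcoord x i = -\<infinity> then -\<infinity> else hcoord x i - hcoord (v i) i)" for i
  have vt: "v i \<in> tspace" for i using v V by blast
  have le: "l i + hcoord (v i) k \<le> hcoord x k" for i k
  proof -
    have "hcoord (v i) k + hcoord x i \<le> hcoord (v i) i + hcoord x k"
      using v(2)[of i] by (auto simp: sector_def)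
    then show ?thesis unfolding l_def
      using sector_le[OF v(2)[of i]] hcoord_tspace[OF xt, of i] hcoord_tspace[OF xt, of k]
        hcoord_tspace[OF vt, of i i] hcoord_tspace[OF vt, of i k]
      by (cases "hcoord x i"; cases "hcoord x k"; cases "hcoord (v i) i"; cases "hcoord (v i) k")
        auto
  qed
  have eq: "l i + hcoord (v i) i = hcoord x i" if "hcoord x i \<noteq> -\<infinity>" for i
    unfolding l_def
    using that sector_le[OF v(2)[of i]] hcoord_tspace[OF xt, of i] hcoord_tspace[OF vt, of i i]
    by (cases "hcoord x i"; cases "hcoord (v i) i") auto
  have sup: "(SUP i. l i + hcoord (v i) k) = hcoord x k" for k
  proof (rule antisym)
    show "(SUP i. l i + hcoord (v i) k) \<le> hcoord x k" by (intro SUP_least le)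
    show "hcoord x k \<le> (SUP i. l i + hcoord (v i) k)"
    proof (cases "hcoord x k = -\<infinity>")
      case False
      then have "hcoord x k = l k + hcoord (v k) k" by (simp add: eq)
      also have "\<dots> \<le> (SUP i. l i + hcoord (v i) k)" by (rule SUP_upper) simp
      finally show ?thesis .
    qed simp
  qed
  \<comment> \<open>One term has been chosen for each element of \<open>'d option\<close>, whereas
    \<open>tconv\<close> asks for a family indexed by \<open>{1..n}\<close>.\<close>
  obtain N and h :: "nat \<Rightarrow> 'd option" where "bij_betw h {1..N} UNIV"
    using ex_bij_betw_nat_finite_1[of "UNIV :: 'd option set"] by auto
  then have h: "h ` {1..N} = UNIV"
    by (rule bij_betw_imp_surj_on)
  have sup_h: "(SUP j\<in>{1..N}. f (h j)) = (SUP i. f i)" for f :: "'d option \<Rightarrow> ereal"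
    by (simp only: h[symmetric] image_image)
  have "l i \<in> trop" for i
    using le[of i None] by (auto simp: trop_def)
  moreover have "(SUP j\<in>{1..N}. l (h j)) = 0"
    using sup[of None] sup_h[of l] by simp
  moreover have "x = (\<chi> m. SUP j\<in>{1..N}. l (h j) + v (h j) $ m)"
  proof (rule vec_eq_iff[THEN iffD2], rule allI)
    fix m
    show "x $ m = (\<chi> m. SUP j\<in>{1..N}. l (h j) + v (h j) $ m) $ m"
      using sup[of "Some m"] sup_h[of "\<lambda>i. l i + v i $ m"] by simp
  qed
  ultimately show "x \<in> tconv V"
    unfolding tconv_def using v(1)
    by (intro CollectI exI[of _ N] exI[of _ "\<lambda>j. l (h j)"] exI[of _ "\<lambda>j. v (h j)"]) blast
qed

lemma tconv_subset_tspace: "V \<subseteq> tspace \<Longrightarrow> tconv V \<subseteq> tspace"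
  by (auto simp: tconv_iff)

lemma sector_refl: "v \<in> sector i v"
  by (simp add: sector_def add.commute)

lemma subset_tconv: "V \<subseteq> tspace \<Longrightarrow> V \<subseteq> tconv V"
  using sector_refl by (fastforce simp: tconv_iff)

lemma tconv_subset_tconv:
  assumes "V \<subseteq> tspace" "U \<subseteq> tconv V"
  shows "tconv U \<subseteq> tconv V"
proof
  fix x assume x: "x \<in> tconv U"
  have U: "U \<subseteq> tspace" using assms tconv_subset_tspace by blast
  have "\<exists>v\<in>V. x \<in> sector i v" for i
  proof -
    obtain u where "u \<in> U" "x \<in> sector i u" using x U by (auto simp: tconv_iff)
    moreover from this obtain v where "v \<in> V" "u \<in> sector i v"
      using assms(2) tconv_iff[OF assms(1)] by blast
    ultimately show ?thesis
      using x U assms(1) tconv_iff[OF U] by (blast intro: sector_trans)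
  qed
  then show "x \<in> tconv V" using x U assms(1) by (simp add: tconv_iff)
qed

section \<open>The vertices of a tropical polytope\<close>

text \<open>Some index \<open>i\<close> separates \<open>v\<close> from the other generators in
  \<open>V\<close>. Passing from \<open>v\<close> to some \<open>w\<close> in \<open>W\<close> and
  on to some \<open>u\<close> in \<open>V\<close> within sectors at \<open>i\<close> forces
  \<open>u = v\<close>, so \<open>v\<close> and \<open>w\<close> lie in each other's sector and
  coincide. Applied to two minimal sets, this gives uniqueness.\<close>

lemma minimal_generating_set_subset:
  assumes V: "minimal_generating_set P V" and W: "W \<subseteq> tspace" "tconv W = P"
  shows "V \<subseteq> W"
proof
  fix v assume v: "v \<in> V"
  have Vt: "V \<subseteq> tspace" and VP: "tconv V = P" using V by (auto simp: minimal_generating_set_def)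
  have Vv: "V - {v} \<subseteq> tspace" using Vt by blast
  \<comment> \<open>Otherwise \<open>V - {v}\<close> would already generate \<open>P\<close>,
    against minimality.\<close>
  have "v \<notin> tconv (V - {v})"
  proof
    assume "v \<in> tconv (V - {v})"
    then have "V \<subseteq> tconv (V - {v})" using subset_tconv[OF Vv] by blast
    then have "tconv V \<subseteq> tconv (V - {v})" by (rule tconv_subset_tconv[OF Vv])
    moreover have "tconv (V - {v}) \<subseteq> tconv V"
      using subset_tconv[OF Vt] by (intro tconv_subset_tconv Vt) blast
    ultimately have "tconv (V - {v}) = P" using VP by blast
    moreover have "V - {v} \<subset> V" using v by blast
    ultimately show False using V by (auto simp: minimal_generating_set_def)
  qed
  then obtain i0 where i0: "\<And>u. u \<in> V - {v} \<Longrightarrow> v \<notin> sector i0 u"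
    using v Vt tconv_iff[OF Vv, of v] by blast
  \<comment> \<open>If \<open>V = {v}\<close> then \<open>i0\<close> is arbitrary, and \<open>v\<close> may have coordinate \<open>-\<infinity>\<close> there.\<close>
  define i where "i = (if V = {v} then None else i0)"
  have i: "u = v" if "u \<in> V" "v \<in> sector i u" for u
    using i0[of u] that by (auto simp: i_def split: if_splits)
  \<comment> \<open>A coordinate \<open>-\<infinity>\<close> would put \<open>v\<close> into the
    sector at \<open>i\<close> of every other generator.\<close>
  have fin: "hcoord v i \<noteq> -\<infinity>"
  proof (cases "V = {v}")
    case False
    then obtain u where "u \<in> V - {v}" using v by blast
    with i[of u] Vt show ?thesis by (auto dest: sector_minus_infinity)
  qed (simp add: i_def)
  have vt: "v \<in> tspace" using v Vt by blast
  have "v \<in> tconv W" using W VP v subset_tconv[OF Vt] by blast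
  then obtain w where w: "w \<in> W" "v \<in> sector i w"
    using tconv_iff[OF W(1)] by blast
  have wt: "w \<in> tspace" using w W by blast
  have "w \<in> tconv V" using w W VP subset_tconv[OF W(1)] by blast
  then obtain u where u: "u \<in> V" "w \<in> sector i u"
    using tconv_iff[OF Vt] by blast
  have "v \<in> sector i u" using sector_trans[OF w(2) u(2)] vt wt u(1) Vt by blast
  then have wv: "w \<in> sector i v" using i u by blast
  have ii: "hcoord w i = hcoord v i" using sector_le[OF wv] sector_le[OF w(2)] by simp
  \<comment> \<open>The two sector inequalities are opposite, and the common finite coordinate at
    \<open>i\<close> cancels.\<close>
  have "w = v"
  proof (rule hcoord_eqI)
    fix k
    have "hcoord w k + hcoord v i \<le> hcoord w i + hcoord v k"
      "hcoord v k + hcoord w i \<le> hcoord v i + hcoord w k"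
      using w(2) wv by (auto simp: sector_def)
    then show "hcoord w k = hcoord v k"
      using ii fin hcoord_tspace[OF vt, of i]
      by (cases "hcoord v i"; cases "hcoord v k"; cases "hcoord w k") auto
  qed
  with w show "v \<in> W" by simp
qed

text \<open>A finite generating set contains a minimal one, and
  \<open>minimal_generating_set_subset\<close> in both directions shows that the description
  \<open>THE\<close> in \<open>vertices\<close> picks it.\<close>

lemma vertices_polytope:
  assumes "tropical_polytope P"
  shows "finite (vertices P)" "vertices P \<subseteq> tspace" "tconv (vertices P) = P"
proof -
  obtain V0 where V0: "finite V0" "V0 \<subseteq> tspace" "P = tconv V0"
    using assms by (auto simp: tropical_polytope_def)
  have "finite {V. V \<subseteq> V0 \<and> tconv V = P}" "{V. V \<subseteq> V0 \<and> tconv V = P} \<noteq> {}"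
    using V0(1) by simp (use V0(3) in blast)
  then obtain V where V: "V \<subseteq> V0" "tconv V = P"
    and min: "\<And>W. W \<subseteq> V0 \<Longrightarrow> tconv W = P \<Longrightarrow> W \<subseteq> V \<Longrightarrow> V = W"
    using finite_has_minimal[of "{V. V \<subseteq> V0 \<and> tconv V = P}"] by auto
  have mgs: "minimal_generating_set P V"
    unfolding minimal_generating_set_def
  proof (intro conjI allI impI notI)
    fix W assume "W \<subset> V" "tconv W = P"
    with min[of W] V show False by blast
  qed (use V V0 in auto)
  have "vertices P = V"
    unfolding vertices_def
  proof (rule the_equality, rule mgs)
    fix W assume "minimal_generating_set P W"
    then show "W = V"
      using minimal_generating_set_subset mgs unfolding minimal_generating_set_def
      by (metis subset_antisym)
  qed
  then show "finite (vertices P)" "vertices P \<subseteq> tspace" "tconv (vertices P) = P"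
    using V V0 finite_subset by auto
qed

section \<open>The covering of a polytope by finitely many closed cells\<close>

text \<open>The index minimises the differences over the finite coordinates of \<open>v\<close>,
  among them \<open>None\<close>; at the remaining indices the left side is
  \<open>-\<infinity>\<close>. This meets the finiteness condition in
  \<open>closed_cells\<close>.\<close>

lemma ex_finite_sector:
  assumes "x \<in> tspace" "v \<in> tspace"
  shows "\<exists>i. x \<in> sector i v \<and> hcoord v i \<noteq> -\<infinity>"
proof -
  let ?K = "{k. hcoord v k \<noteq> -\<infinity>}"
  have "finite ?K" "?K \<noteq> {}" by (auto intro: exI[of _ None])
  then obtain i where i: "i \<in> ?K"
    and min: "\<And>k. k \<in> ?K \<Longrightarrow> hcoord x i - hcoord v i \<le> hcoord x k - hcoord v k"
    using arg_min_least[of ?K _ "\<lambda>k. hcoord x k - hcoord v k"]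
      arg_min_if_finite(1)[of ?K "\<lambda>k. hcoord x k - hcoord v k"] by blast
  have "hcoord v k + hcoord x i \<le> hcoord v i + hcoord x k" for k
    using i min[of k] hcoord_tspace[OF assms(1), of i] hcoord_tspace[OF assms(1), of k]
      hcoord_tspace[OF assms(2), of i] hcoord_tspace[OF assms(2), of k]
    by (cases "hcoord x i"; cases "hcoord x k"; cases "hcoord v i"; cases "hcoord v k") auto
  with i show ?thesis by (auto simp: sector_def)
qed

lemma covector_cell_eq: "covector_cell G = {x \<in> tspace. \<forall>(i, v)\<in>G. x \<in> sector i v}"
  by (auto simp: covector_cell_def sector_def)

lemma Union_closed_cells:
  assumes "tropical_polytope P"
  shows "\<Union>(closed_cells P) = P"
proof
  note v = vertices_polytope[OF assms]
  have P: "x \<in> P \<longleftrightarrow> x \<in> tspace \<and> (\<forall>i. \<exists>v\<in>vertices P. x \<in> sector i v)" for x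
    using tconv_iff[OF v(2)] v(3) by simp
  show "\<Union>(closed_cells P) \<subseteq> P"
    by (fastforce simp: closed_cells_def covector_cell_eq P)
  show "P \<subseteq> \<Union>(closed_cells P)"
  proof
    fix x assume x: "x \<in> P"
    \<comment> \<open>The covector of \<open>x\<close>: the largest set of pairs with vertices of
      \<open>P\<close> whose cell contains \<open>x\<close>.\<close>
    define G where "G = {(i, v). v \<in> vertices P \<and> x \<in> sector i v}"
    have "x \<in> covector_cell G" using x by (auto simp: covector_cell_eq G_def P)
    moreover have "\<exists>i. (i, v) \<in> G \<and> hcoord v i \<noteq> -\<infinity>" if "v \<in> vertices P" for v
      using ex_finite_sector[of x v] that x v(2) by (auto simp: G_def P)
    moreover have "\<exists>v. (i, v) \<in> G" for i using x by (auto simp: G_def P)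
    moreover have "G \<subseteq> UNIV \<times> vertices P" by (auto simp: G_def)
    ultimately have "covector_cell G \<in> closed_cells P"
      unfolding closed_cells_def by blast
    with \<open>x \<in> covector_cell G\<close> show "x \<in> \<Union>(closed_cells P)" by blast
  qed
qed

lemma finite_closed_cells:
  assumes "tropical_polytope P"
  shows "finite (closed_cells P)"
proof (rule finite_subset)
  show "closed_cells P \<subseteq> covector_cell ` Pow (UNIV \<times> vertices P)"
    by (auto simp: closed_cells_def)
  show "finite (covector_cell ` Pow (UNIV \<times> vertices P))"
    using vertices_polytope(1)[OF assms] by simp
qed

section \<open>Exponential coordinates\<close>

definition sexp :: "real \<Rightarrow> ereal \<Rightarrow> real" where
  "sexp b a = (if a = -\<infinity> then 0 else b powr real_of_ereal a)"

lemma texp_nth [simp]: "texp b x $ i = sexp b (x $ i)"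
  by (simp add: texp_def sexp_def)

text \<open>The exponential counterpart of \<open>hcoord\<close>: the coordinate \<open>0\<close> at
  the additional index becomes \<open>1\<close>, so that the cell inequalities turn into affine
  ones.\<close>

definition hreal :: "real^'n \<Rightarrow> 'n option \<Rightarrow> real" where
  "hreal y i = (case i of None \<Rightarrow> 1 | Some m \<Rightarrow> y $ m)"

lemma hreal_affine:
  "s + t = 1 \<Longrightarrow> hreal (s *\<^sub>R x + t *\<^sub>R y) i = s * hreal x i + t * hreal y i"
  by (cases i) (auto simp: hreal_def)

lemma continuous_on_hreal: "continuous_on A (\<lambda>y. hreal y i)"
  by (cases i) (auto simp: hreal_def intro!: continuous_intros)

context
  fixes b :: real
  assumes b: "b > 1"
begin

lemma sexp_add: "a \<noteq> \<infinity> \<Longrightarrow> c \<noteq> \<infinity> \<Longrightarrow> sexp b (a + c) = sexp b a * sexp b c"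
  by (cases a; cases c) (auto simp: sexp_def powr_add)

lemma sexp_zero [simp]: "sexp b 0 = 1"
  using b by (simp add: sexp_def)

lemma sexp_le_iff: "a \<noteq> \<infinity> \<Longrightarrow> c \<noteq> \<infinity> \<Longrightarrow> sexp b a \<le> sexp b c \<longleftrightarrow> a \<le> c"
  using b by (cases a; cases c) (auto simp: sexp_def not_le)

lemma sexp_nonneg: "sexp b a \<ge> 0"
  using b by (simp add: sexp_def)

lemma sexp_surj:
  assumes "t \<ge> 0"
  shows "\<exists>a\<in>trop. sexp b a = t"
proof (cases "t = 0")
  case True
  then show ?thesis by (intro bexI[of _ "-\<infinity>"]) (auto simp: sexp_def trop_def)
next
  case False
  with assms b show ?thesis
    by (intro bexI[of _ "ereal (log b t)"]) (auto simp: sexp_def trop_def)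
qed

lemma inj_on_texp: "inj_on (texp b) tspace"
proof (rule inj_onI)
  fix x y :: "ereal^'n" assume xy: "x \<in> tspace" "y \<in> tspace" "texp b x = texp b y"
  show "x = y"
  proof (rule vec_eq_iff[THEN iffD2], rule allI)
    fix i
    have "sexp b (x $ i) = sexp b (y $ i)" using xy(3) by (metis texp_nth)
    moreover have "x $ i \<noteq> \<infinity>" "y $ i \<noteq> \<infinity>" using xy by (auto simp: tspace_def trop_def)
    ultimately show "x $ i = y $ i" using sexp_le_iff by (metis order_antisym order_refl)
  qed
qed

lemma texp_surj:
  fixes y :: "real^'n"
  assumes "\<And>i. y $ i \<ge> 0"
  shows "\<exists>x\<in>tspace. texp b x = y"
proof -
  obtain f where f: "\<And>i. f i \<in> trop \<and> sexp b (f i) = y $ i"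
    using sexp_surj[OF assms] by metis
  then show ?thesis
    by (intro bexI[of _ "\<chi> i. f i"]) (auto simp: vec_eq_iff tspace_def)
qed

text \<open>The first conjunct is carried along because \<open>sexp_add\<close> excludes
  \<open>\<infinity>\<close> in the induction step.\<close>

lemma sexp_sum:
  assumes "\<And>i. i \<in> A \<Longrightarrow> f i \<noteq> \<infinity>" "finite A"
  shows "(\<Sum>i\<in>A. f i) \<noteq> \<infinity> \<and> sexp b (\<Sum>i\<in>A. f i) = (\<Prod>i\<in>A. sexp b (f i))"
  using assms(2,1) by (induction A rule: finite_induct) (auto simp: sexp_add)

lemma hreal_texp: "hreal (texp b x) i = sexp b (hcoord x i)"
  by (cases i) (auto simp: hreal_def)

text \<open>Exponentiation is increasing and turns sums into products, so each cell inequality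
  becomes a closed half-space, possibly trivial. The nonnegative orthant is the image of
  \<open>tspace\<close>.\<close>

lemma texp_covector_cell:
  assumes G: "G \<subseteq> UNIV \<times> tspace"
  shows "texp b ` covector_cell G =
    (\<Inter>i. {y. 0 \<le> y $ i}) \<inter>
    (\<Inter>(i, v)\<in>G. \<Inter>k. {y. sexp b (hcoord v k) * hreal y i \<le> sexp b (hcoord v i) * hreal y k})"
    (is "_ = ?R")
proof -
  have iff: "x \<in> covector_cell G \<longleftrightarrow> texp b x \<in> ?R" if x: "x \<in> tspace" for x
  proof -
    have "hcoord v k + hcoord x i \<le> hcoord v i + hcoord x k \<longleftrightarrow>
        sexp b (hcoord v k) * sexp b (hcoord x i) \<le> sexp b (hcoord v i) * sexp b (hcoord x k)"
      if "(i, v) \<in> G" for i v k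
      using hcoord_tspace[OF x] hcoord_tspace[of v] G that
      by (auto simp add: sexp_add[symmetric] sexp_le_iff)
    then show ?thesis using x
      by (fastforce simp: covector_cell_def hreal_texp sexp_nonneg)
  qed
  show ?thesis
  proof
    show "texp b ` covector_cell G \<subseteq> ?R"
      using iff by (auto simp: covector_cell_def simp del: INT_iff Int_iff)
    show "?R \<subseteq> texp b ` covector_cell G"
    proof
      fix y assume y: "y \<in> ?R"
      then obtain x where "x \<in> tspace" "texp b x = y" using texp_surj[of y] by auto
      with y iff show "y \<in> texp b ` covector_cell G" by blast
    qed
  qed
qed

lemma closed_convex_texp_cell:
  fixes G :: "('d option \<times> (ereal^'d)) set"
  assumes G: "G \<subseteq> UNIV \<times> tspace"
  shows "closed (texp b ` covector_cell G)" "convex (texp b ` covector_cell G)"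
proof -
  have hs: "convex {y. c * hreal y i \<le> d * hreal y k}" for c d and i k :: "'d option"
    unfolding convex_def
  proof (intro ballI allI impI CollectI)
    fix x y and s t :: real
    assume st: "0 \<le> s" "0 \<le> t" "s + t = 1" and x: "x \<in> {y. c * hreal y i \<le> d * hreal y k}"
      and y: "y \<in> {y. c * hreal y i \<le> d * hreal y k}"
    have "s * (c * hreal x i) + t * (c * hreal y i) \<le> s * (d * hreal x k) + t * (d * hreal y k)"
      using st x y by (intro add_mono mult_left_mono) auto
    then show "c * hreal (s *\<^sub>R x + t *\<^sub>R y) i \<le> d * hreal (s *\<^sub>R x + t *\<^sub>R y) k"
      using st by (simp add: hreal_affine algebra_simps)
  qed
  \<comment> \<open>The orthant condition is the affine inequality
    \<open>0 * 1 \<le> 1 * y $ i\<close>, the \<open>1\<close> on the left being the coordinate at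
    \<open>None\<close>.\<close>
  have "convex {y :: real^'d. 0 \<le> y $ i}" for i
    using hs[of 0 None 1 "Some i"] by (simp add: hreal_def)
  then show "convex (texp b ` covector_cell G)"
    unfolding texp_covector_cell[OF G] using hs
    by (intro convex_Int convex_INT) (auto intro!: convex_INT)
  show "closed (texp b ` covector_cell G)"
    unfolding texp_covector_cell[OF G]
    by (intro closed_Int closed_INT ballI)
      (auto intro!: closed_INT closed_Collect_le continuous_intros continuous_on_hreal)
qed

end

section \<open>The trunk is the regular part of the polytope\<close>

lemma interior_Union_empty:
  fixes F :: "'a::topological_space set set"
  assumes "finite F" "\<And>D. D \<in> F \<Longrightarrow> closed D" "\<And>D. D \<in> F \<Longrightarrow> interior D = {}"
  shows "interior (\<Union>F) = {}"
  using assms by (induction F rule: finite_induct) (auto simp: interior_closed_Un_empty_interior)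

text \<open>A convex set has full dimension exactly if its interior is nonempty, and it then lies in
  the closure of that interior. The members of smaller dimension together have no interior and add
  nothing to the right side.\<close>

lemma Union_full_dim_eq:
  fixes F :: "'a::euclidean_space set set"
  assumes "finite F" and cl: "\<And>D. D \<in> F \<Longrightarrow> closed D" and cv: "\<And>D. D \<in> F \<Longrightarrow> convex D"
  shows "\<Union>{D \<in> F. aff_dim D = int DIM('a)} = closure (interior (\<Union>F))"
proof
  have full: "aff_dim D = int DIM('a) \<longleftrightarrow> interior D \<noteq> {}" if "D \<in> F" for D
    using interior_rel_interior_gen[of D] rel_interior_eq_empty[OF cv[OF that]] by auto
  show "\<Union>{D \<in> F. aff_dim D = int DIM('a)} \<subseteq> closure (interior (\<Union>F))"
  proof safe
    fix x D assume D: "x \<in> D" "D \<in> F" "aff_dim D = int DIM('a)"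
    have "D \<subseteq> closure (interior D)"
      using convex_closure_interior[OF cv] full D closure_subset by blast
    also have "\<dots> \<subseteq> closure (interior (\<Union>F))"
      using D by (intro closure_mono interior_mono) auto
    finally show "x \<in> closure (interior (\<Union>F))" using D by blast
  qed
  let ?A = "\<Union>{D \<in> F. aff_dim D = int DIM('a)}" and ?B = "\<Union>{D \<in> F. interior D = {}}"
  have A: "closed ?A" using assms by (intro closed_Union) auto
  have "interior ?B = {}" using assms by (intro interior_Union_empty) auto
  \<comment> \<open>This difference is open because \<open>?A\<close> is closed, so it lies in the
    empty interior of \<open>?B\<close>.\<close>
  moreover have "interior (\<Union>F) - ?A \<subseteq> ?B"
  proof
    fix x assume x: "x \<in> interior (\<Union>F) - ?A"
    then obtain D where "D \<in> F" "x \<in> D" using interior_subset[of "\<Union>F"] by blast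
    with full[of D] x show "x \<in> ?B" by blast
  qed
  then have "interior (\<Union>F) - ?A \<subseteq> interior ?B"
    using A by (intro interior_maximal) auto
  ultimately have "interior (\<Union>F) \<subseteq> ?A" by auto
  then show "closure (interior (\<Union>F)) \<subseteq> ?A" using A by (rule closure_minimal)
qed

lemma texp_trunk:
  fixes P :: "(ereal^'d) set"
  assumes b: "b > 1" and P: "tropical_polytope P"
  shows "texp b ` trunk b P = closure (interior (texp b ` P))"
proof -
  let ?F = "(\<lambda>C. texp b ` C) ` closed_cells P"
  have cell: "closed (texp b ` C) \<and> convex (texp b ` C)" if C: "C \<in> closed_cells P" for C
  proof -
    obtain G where "C = covector_cell G" "G \<subseteq> UNIV \<times> vertices P"
      using C unfolding closed_cells_def by blast
    moreover from this have "G \<subseteq> UNIV \<times> tspace" using vertices_polytope(2)[OF P] by blast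
    ultimately show ?thesis using closed_convex_texp_cell[OF b, of G] by simp
  qed
  have "texp b ` trunk b P = \<Union>{D \<in> ?F. aff_dim D = int DIM(real^'d)}"
    unfolding trunk_def cell_dim_def image_Union by (rule arg_cong[where f = Union]) auto
  also have "\<dots> = closure (interior (\<Union>?F))"
    using cell finite_closed_cells[OF P] by (intro Union_full_dim_eq) auto
  also have "\<Union>?F = texp b ` P"
    by (simp only: image_Union[symmetric] Union_closed_cells[OF P])
  finally show ?thesis .
qed

lemma polytope_subset_tspace: "tropical_polytope P \<Longrightarrow> P \<subseteq> tspace"
  by (metis tconv_subset_tspace vertices_polytope(2,3))

lemma trunk_subset: "tropical_polytope P \<Longrightarrow> trunk b P \<subseteq> P"
  by (subst Union_closed_cells[symmetric]) (auto simp only: trunk_def Union_iff mem_Collect_eq)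

lemma trunk_subset_tspace: "tropical_polytope P \<Longrightarrow> trunk b P \<subseteq> tspace"
  by (rule subset_trans[OF trunk_subset polytope_subset_tspace])

section \<open>Compactness of the trunk and attainment of the maximum\<close>

text \<open>By \<open>sector_le\<close> each coordinate of a point of \<open>P\<close> is at most
  that of some generator, so the image of \<open>P\<close> is bounded; the image of the trunk is
  closed by \<open>texp_trunk\<close>.\<close>

lemma compact_texp_trunk:
  fixes P :: "(ereal^'d) set"
  assumes b: "b > 1" and P: "tropical_polytope P"
  shows "compact (texp b ` trunk b P)"
proof -
  obtain V where V: "finite V" "V \<subseteq> tspace" "P = tconv V"
    using P by (auto simp: tropical_polytope_def)
  \<comment> \<open>The sum is a crude common bound for the generators, whose images are
    nonnegative.\<close>
  have "texp b x \<in> cbox 0 (\<Sum>v\<in>V. texp b v)" if x: "x \<in> P" for x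
    unfolding mem_box_cart
  proof (intro allI conjI)
    fix i
    show "0 $ i \<le> texp b x $ i" using sexp_nonneg[OF b] by simp
    obtain v where v: "v \<in> V" "x \<in> sector (Some i) v"
      using x tconv_iff[OF V(2)] V(3) by blast
    have "x \<in> tspace" using x polytope_subset_tspace[OF P] by blast
    then have "texp b x $ i \<le> texp b v $ i"
      using sector_le[OF v(2)] v V by (auto simp: sexp_le_iff[OF b] tspace_def trop_def)
    also have "\<dots> \<le> (\<Sum>v\<in>V. texp b v $ i)"
      using v V sexp_nonneg[OF b] by (intro member_le_sum) auto
    finally show "texp b x $ i \<le> (\<Sum>v\<in>V. texp b v) $ i" by simp
  qed
  then have "bounded (texp b ` P)" by (intro bounded_subset[OF bounded_cbox]) blast
  then show ?thesis
    unfolding texp_trunk[OF b P] by (simp add: compact_eq_bounded_closed bounded_closure bounded_interior)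
qed

text \<open>In exponential coordinates the sum becomes a product, which is continuous even where
  coordinates are \<open>-\<infinity>\<close>. Its maximum on the compact image gives the value that
  \<open>GREATEST\<close> in \<open>tbvol\<close> denotes.\<close>

lemma trunk_maximum:
  fixes P :: "(ereal^'d) set"
  assumes b: "b > 1" and P: "tropical_polytope P" and ne: "trunk b P \<noteq> {}"
  obtains x where "x \<in> trunk b P" "\<And>y. y \<in> trunk b P \<Longrightarrow> (\<Sum>i\<in>UNIV. y $ i) \<le> (\<Sum>i\<in>UNIV. x $ i)"
proof -
  have "continuous_on (texp b ` trunk b P) (\<lambda>y. \<Prod>i\<in>UNIV. y $ i)"
    by (intro continuous_intros)
  from continuous_attains_sup[OF compact_texp_trunk[OF b P] _ this] ne
  obtain x where x: "x \<in> trunk b P"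
    and max: "\<And>y. y \<in> trunk b P \<Longrightarrow> (\<Prod>i\<in>UNIV. texp b y $ i) \<le> (\<Prod>i\<in>UNIV. texp b x $ i)"
    by auto
  show ?thesis
  proof (rule that[OF x])
    fix y assume y: "y \<in> trunk b P"
    have "x $ i \<noteq> \<infinity>" "y $ i \<noteq> \<infinity>" for i
      using subsetD[OF trunk_subset_tspace[OF P] x] subsetD[OF trunk_subset_tspace[OF P] y]
      by (auto simp: tspace_def trop_def)
    then show "(\<Sum>i\<in>UNIV. y $ i) \<le> (\<Sum>i\<in>UNIV. x $ i)"
      using max[OF y] sexp_sum[OF b, of UNIV "\<lambda>i. x $ i"] sexp_sum[OF b, of UNIV "\<lambda>i. y $ i"]
      by (simp add: sexp_le_iff[OF b, symmetric])
  qed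
qed

lemma tbvol_eqI:
  assumes "x \<in> trunk b P" "\<And>y. y \<in> trunk b P \<Longrightarrow> (\<Sum>i\<in>UNIV. y $ i) \<le> (\<Sum>i\<in>UNIV. x $ i)"
  shows "tbvol b P = (\<Sum>i\<in>UNIV. x $ i)"
  using assms unfolding tbvol_def by (auto intro!: Greatest_equality)

text \<open>Meant for the case of an empty trunk: in \<open>ereal\<close>,
  \<open>-\<infinity>\<close> absorbs only summands different from
  \<open>\<infinity>\<close>.\<close>

lemma tbvol_not_infinity:
  assumes b: "b > 1" and P: "tropical_polytope P"
  shows "tbvol b P \<noteq> \<infinity>"
proof (cases "trunk b P = {}")
  case False
  then obtain x where x: "x \<in> trunk b P"
    "\<And>y. y \<in> trunk b P \<Longrightarrow> (\<Sum>i\<in>UNIV. y $ i) \<le> (\<Sum>i\<in>UNIV. x $ i)"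
    using trunk_maximum[OF b P] by blast
  then have "x \<in> tspace" using trunk_subset_tspace[OF P] by blast
  then show ?thesis
    using tbvol_eqI[OF x] sexp_sum[OF b, of UNIV "\<lambda>i. x $ i"]
    by (simp add: tspace_def trop_def)
qed (simp add: tbvol_def)

section \<open>Products\<close>

text \<open>The entry type is left open so that the same maps serve tropical points and their real
  images.\<close>

definition left :: "'a^('d::finite + 'e::finite) \<Rightarrow> 'a^'d" where "left x = (\<chi> i. x $ Inl i)"
definition right :: "'a^('d::finite + 'e::finite) \<Rightarrow> 'a^'e" where "right x = (\<chi> j. x $ Inr j)"
definition join :: "'a^'d::finite \<Rightarrow> 'a^'e::finite \<Rightarrow> 'a^('d + 'e)" where
  "join x y = (\<chi> k. case k of Inl i \<Rightarrow> x $ i | Inr j \<Rightarrow> y $ j)"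

lemma left_nth [simp]: "left x $ i = x $ Inl i"
  and right_nth [simp]: "right x $ j = x $ Inr j"
  and join_Inl [simp]: "join y z $ Inl i = y $ i"
  and join_Inr [simp]: "join y z $ Inr j = z $ j"
  by (simp_all add: left_def right_def join_def)

lemma left_join [simp]: "left (join x y) = x"
  and right_join [simp]: "right (join x y) = y"
  by (simp_all add: vec_eq_iff)

lemma join_left_right [simp]: "join (left x) (right x) = x"
  unfolding vec_eq_iff join_def by (auto split: sum.split)

lemma mem_tprod: "x \<in> tprod P Q \<longleftrightarrow> left x \<in> P \<and> right x \<in> Q"
  by (simp add: tprod_def left_def right_def)

lemma tspace_left_right: "x \<in> tspace \<longleftrightarrow> left x \<in> tspace \<and> right x \<in> tspace"
  unfolding tspace_def mem_Collect_eq left_nth right_nth by (metis sumE)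

lemma hcoord_left: "hcoord (left x) i = hcoord x (map_option Inl i)"
  and hcoord_right: "hcoord (right x) j = hcoord x (map_option Inr j)"
  by (cases i; simp) (cases j; simp)

lemma sector_left: "x \<in> sector (map_option Inl i) v \<Longrightarrow> left x \<in> sector i (left v)"
  and sector_right: "x \<in> sector (map_option Inr j) v \<Longrightarrow> right x \<in> sector j (right v)"
  by (auto simp: sector_def hcoord_left hcoord_right)

text \<open>The two cases overlap at \<open>None\<close>, the index \<open>0\<close> shared by both
  factors.\<close>

lemma option_sum_cases:
  obtains i where "k = map_option Inl i" | j where "k = map_option Inr j"
  by (metis not_None_eq option.simps(8,9) sumE)

lemma hcoord_join [simp]:
  "hcoord (join x y) (map_option Inl i) = hcoord x i"
  "hcoord (join x y) (map_option Inr j) = hcoord y j"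
  by (simp_all flip: hcoord_left hcoord_right)

text \<open>All differences of \<open>y\<close> and \<open>w\<close> are at least \<open>0\<close>
  because their minimum is at \<open>None\<close>, while the difference of \<open>x\<close> and
  \<open>v\<close> at \<open>i\<close> is at most \<open>0\<close>. So \<open>i\<close> stays
  minimal among the joint indices.\<close>

lemma sector_join_Inl:
  assumes "x \<in> sector i v" "y \<in> sector None w"
  shows "join x y \<in> sector (map_option Inl i) (join v w)"
  unfolding sector_def
proof (intro CollectI allI)
  fix k
  show "hcoord (join v w) k + hcoord (join x y) (map_option Inl i)
    \<le> hcoord (join v w) (map_option Inl i) + hcoord (join x y) k"
  proof (cases k rule: option_sum_cases)
    case 1
    then show ?thesis using assms(1) by (simp add: sector_def)
  next
    case (2 j)
    have "hcoord w j \<le> hcoord y j" using assms(2) by (auto simp: sector_def)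
    then show ?thesis
      using sector_le[OF assms(1)] by (simp add: 2 add.commute[of "hcoord w j"] add_mono)
  qed
qed

lemma sector_join_Inr:
  assumes "x \<in> sector None v" "y \<in> sector j w"
  shows "join x y \<in> sector (map_option Inr j) (join v w)"
  unfolding sector_def
proof (intro CollectI allI)
  fix k
  show "hcoord (join v w) k + hcoord (join x y) (map_option Inr j)
    \<le> hcoord (join v w) (map_option Inr j) + hcoord (join x y) k"
  proof (cases k rule: option_sum_cases)
    case 2
    then show ?thesis using assms(2) by (simp add: sector_def)
  next
    case (1 i)
    have "hcoord v i \<le> hcoord x i" using assms(1) by (auto simp: sector_def)
    then show ?thesis
      using sector_le[OF assms(2)] by (simp add: 1 add.commute[of "hcoord v i"] add_mono)
  qed
qed

section \<open>Generators and trunks of products\<close>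

lemma tprod_tconv:
  assumes V: "V \<subseteq> tspace" and W: "W \<subseteq> tspace"
  shows "tprod (tconv V) (tconv W) = tconv (tprod V W)"
proof (rule set_eqI)
  fix x :: "ereal^('a + 'b)"
  have VW: "tprod V W \<subseteq> tspace"
    using V W by (auto simp: mem_tprod tspace_left_right)
  have "(\<forall>k. \<exists>u\<in>tprod V W. x \<in> sector k u) \<longleftrightarrow>
      (\<forall>i. \<exists>v\<in>V. left x \<in> sector i v) \<and> (\<forall>j. \<exists>w\<in>W. right x \<in> sector j w)" (is "?L \<longleftrightarrow> ?R")
  proof
    assume ?L
    then show ?R by (metis mem_tprod sector_left sector_right)
  next
    assume R: ?R
    show ?L
    proof
      fix k
      \<comment> \<open>Generators for index \<open>0\<close> serve as partners: one chosen for an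
        index of one factor is joined with that of the other factor.\<close>
      obtain v0 w0 where 0: "v0 \<in> V" "left x \<in> sector None v0" "w0 \<in> W" "right x \<in> sector None w0"
        using R by blast
      show "\<exists>u\<in>tprod V W. x \<in> sector k u"
      proof (cases k rule: option_sum_cases)
        case (1 i)
        obtain v where "v \<in> V" "left x \<in> sector i v" using R by blast
        with sector_join_Inl[of "left x" i v "right x" w0] 0 1 show ?thesis
          by (intro bexI[of _ "join v w0"]) (auto simp: mem_tprod)
      next
        case (2 j)
        obtain w where "w \<in> W" "right x \<in> sector j w" using R by blast
        with sector_join_Inr[of "left x" v0 "right x" j w] 0 2 show ?thesis
          by (intro bexI[of _ "join v0 w"]) (auto simp: mem_tprod)
      qed
    qed
  qed
  then show "x \<in> tprod (tconv V) (tconv W) \<longleftrightarrow> x \<in> tconv (tprod V W)"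
    using tspace_left_right[of x] by (auto simp: mem_tprod tconv_iff V W VW)
qed

lemma finite_tprod:
  assumes "finite V" "finite W"
  shows "finite (tprod V W)"
proof (rule finite_subset)
  show "tprod V W \<subseteq> (\<lambda>(x, y). join x y) ` (V \<times> W)"
    by (force simp: mem_tprod image_iff)
  show "finite ((\<lambda>(x, y). join x y) ` (V \<times> W))" using assms by simp
qed

lemma tropical_polytope_tprod:
  assumes "tropical_polytope P" "tropical_polytope Q"
  shows "tropical_polytope (tprod P Q)"
proof -
  obtain V W where "finite V" "V \<subseteq> tspace" "P = tconv V" "finite W" "W \<subseteq> tspace" "Q = tconv W"
    using assms by (auto simp: tropical_polytope_def)
  moreover from this have "tprod V W \<subseteq> tspace"
    by (auto simp: mem_tprod tspace_left_right)
  ultimately show ?thesis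
    unfolding tropical_polytope_def
    by (intro exI[of _ "tprod V W"]) (simp add: tprod_tconv finite_tprod)
qed

text \<open>Joining coordinates is a linear bijection, hence commutes with interior and closure, and
  both commute with products.\<close>

lemma closure_interior_join:
  fixes S :: "(real^'d) set" and T :: "(real^'e) set"
  shows "closure (interior ((\<lambda>(x, y). join x y) ` (S \<times> T))) =
    (\<lambda>(x, y). join x y) ` (closure (interior S) \<times> closure (interior T))"
proof -
  let ?j = "\<lambda>(x :: real^'d, y :: real^'e). join x y"
  have lin: "linear ?j"
    by (rule linearI) (auto simp: vec_eq_iff join_def split: sum.split)
  have inj: "inj ?j"
    by (rule injI) (metis (mono_tags, lifting) case_prod_beta left_join right_join prod_eqI)
  moreover have "surj ?j"
    by (rule surjI[of _ "\<lambda>x. (left x, right x)"]) simp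
  ultimately have "bij ?j" by (rule bijI)
  then show ?thesis
    by (simp add: interior_bijective_linear_image[OF lin] interior_Times closure_Times
        flip: closure_injective_linear_image[OF lin inj])
qed

text \<open>Both sides lie in \<open>tspace\<close>, where \<open>texp b\<close> is injective, so it
  is enough to compare their images by \<open>texp_trunk\<close>.\<close>

lemma trunk_tprod:
  fixes P :: "(ereal^'d) set" and Q :: "(ereal^'e) set"
  assumes b: "b > 1" and P: "tropical_polytope P" and Q: "tropical_polytope Q"
  shows "trunk b (tprod P Q) = tprod (trunk b P) (trunk b Q)"
proof -
  let ?j = "\<lambda>(x :: real^'d, y :: real^'e). join x y"
  note PQ = tropical_polytope_tprod[OF P Q]
  have j: "texp b (join x y) = join (texp b x) (texp b y)" for x :: "ereal^'d" and y :: "ereal^'e"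
    unfolding vec_eq_iff by (auto simp: join_def split: sum.split)
  have tp: "tprod A B = (\<lambda>(x, y). join x y) ` (A \<times> B)" for A :: "(ereal^'d) set" and B :: "(ereal^'e) set"
    by (force simp: mem_tprod image_iff)
  have t: "texp b ` tprod A B = ?j ` ((texp b ` A) \<times> (texp b ` B))"
    for A :: "(ereal^'d) set" and B :: "(ereal^'e) set"
    by (force simp: tp j image_iff)
  have "texp b ` trunk b (tprod P Q) = texp b ` tprod (trunk b P) (trunk b Q)"
    unfolding texp_trunk[OF b PQ] t closure_interior_join
    by (simp add: texp_trunk b P Q)
  moreover have "trunk b (tprod P Q) \<subseteq> tspace"
    by (rule trunk_subset_tspace[OF PQ])
  moreover have "tprod (trunk b P) (trunk b Q) \<subseteq> tspace"
    using trunk_subset_tspace[OF P, of b] trunk_subset_tspace[OF Q, of b]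
    unfolding subset_iff mem_tprod tspace_left_right by blast
  ultimately show ?thesis
    using inj_on_image_eq_iff[OF inj_on_texp[OF b]] by blast
qed

lemma sum_left_right:
  fixes x :: "'a::comm_monoid_add^('d::finite + 'e::finite)"
  shows "(\<Sum>k\<in>UNIV. x $ k) = (\<Sum>i\<in>UNIV. left x $ i) + (\<Sum>j\<in>UNIV. right x $ j)"
  unfolding UNIV_Plus_UNIV[symmetric] by (subst sum.Plus) auto

theorem proposition4p10:
  fixes P :: "(ereal^'d) set" and Q :: "(ereal^'e) set" and b :: real
  assumes "b > 1"
    and "tropical_polytope P"
    and "tropical_polytope Q"
  shows "tropical_polytope (tprod P Q) \<and>
         tbvol b (tprod P Q) = tbvol b P + tbvol b Q"
proof
  show "tropical_polytope (tprod P Q)" by (rule tropical_polytope_tprod) fact+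
  note tr = trunk_tprod[OF assms]
  show "tbvol b (tprod P Q) = tbvol b P + tbvol b Q"
  proof (cases "trunk b P = {} \<or> trunk b Q = {}")
    case True
    then have "trunk b (tprod P Q) = {}" by (auto simp: tr mem_tprod)
    then have "tbvol b (tprod P Q) = -\<infinity>" by (simp add: tbvol_def)
    moreover have "tbvol b P = -\<infinity> \<or> tbvol b Q = -\<infinity>" using True by (auto simp: tbvol_def)
    ultimately show ?thesis
      using tbvol_not_infinity[OF assms(1,2)] tbvol_not_infinity[OF assms(1,3)] by auto
  next
    case False
    obtain x where x: "x \<in> trunk b P"
      "\<And>y. y \<in> trunk b P \<Longrightarrow> (\<Sum>i\<in>UNIV. y $ i) \<le> (\<Sum>i\<in>UNIV. x $ i)"
      using trunk_maximum[OF assms(1,2)] False by blast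
    obtain y where y: "y \<in> trunk b Q"
      "\<And>z. z \<in> trunk b Q \<Longrightarrow> (\<Sum>i\<in>UNIV. z $ i) \<le> (\<Sum>i\<in>UNIV. y $ i)"
      using trunk_maximum[OF assms(1,3)] False by blast
    \<comment> \<open>The two coordinate blocks vary independently, so joining the two maximisers
      gives a maximiser.\<close>
    have "tbvol b (tprod P Q) = (\<Sum>k\<in>UNIV. join x y $ k)"
    proof (rule tbvol_eqI)
      show "join x y \<in> trunk b (tprod P Q)" using x y by (simp add: tr mem_tprod)
      fix z assume "z \<in> trunk b (tprod P Q)"
      then have "left z \<in> trunk b P" "right z \<in> trunk b Q" by (auto simp: tr mem_tprod)
      then show "(\<Sum>k\<in>UNIV. z $ k) \<le> (\<Sum>k\<in>UNIV. join x y $ k)"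
        unfolding sum_left_right left_join right_join by (intro add_mono x(2) y(2))
    qed
    then show ?thesis
      by (simp only: sum_left_right left_join right_join tbvol_eqI[OF x] tbvol_eqI[OF y])
  qed
qed

end
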